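(* Let $\mathcal{A}\subset\mathbb{Z}^d$ be an arbitrary finite index set, and let $n$ be a prime number satisfying $$ n > \max\Big\{\frac{\#(\mathcal{A}\setminus\{\boldsymbol{0}\})}{\kappa}+1,\ \max(\mathcal{A})\Big\},$$ with $\kappa=2$ if $\mathcal{A}$ is centrally symmetric and $\kappa=1$ otherwise. For $s=1,\ldots,d$ let the projections $\mathcal{A}_s\subset\mathbb{Z}^s$ be defined either (for all $s$) by the zero projection $$\mathcal{A}_s=\{\boldsymbol{h}\in\mathbb{Z}^s : (\boldsymbol{h},\boldsymbol{0})\in\mathcal{A}\},$$ or (for all $s$) by the full projection $$\mathcal{A}_s=\{\boldsymbol{h}\in\mathbb{Z}^s : (\boldsymbol{h},\boldsymbol{h}_\perp)\in\mathcal{A}\ \text{for some}\ \boldsymbol{h}_\perp\in\mathbb{Z}^{d-s}\}.$$ Then (for either choice of projections) a generating vector $\boldsymbol{z}^*=(z_1,\ldots,z_d)\in(\mathbb{Z}_n^* )^d$ can be constructed component-by-component such that for all $s=1,\ldots,d$ and $\boldsymbol{z}=(z_1,\ldots,z_s)$ we have $$\boldsymbol{h}\cdot\boldsymbol{z}\not\equiv 0 \pmod n\qquad\text{for all } \boldsymbol{h}\in\mathcal{A}_s\setminus\{\boldsymbol{0}\}.$$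
   Context: $\mathbb{Z}_n^*:=\{1,\ldots,n-1\}$ for $n$ prime. $\#$ denotes cardinality. $\max(\mathcal{A}):=\max_{\boldsymbol{h}\in\mathcal{A}}\max_{1\le j\le d}|h_j|$. $\mathcal{A}$ is centrally symmetric if $-\boldsymbol{h}\in\mathcal{A}$ whenever $\boldsymbol{h}\in\mathcal{A}$. $\boldsymbol{h}\cdot\boldsymbol{z}=h_1z_1+\cdots+h_sz_s$. "Constructed component-by-component" means that the components are chosen one at a time: for $s=1,\ldots,d$, once $z_1,\ldots,z_{s-1}\in\mathbb{Z}_n^*$ have been chosen satisfying the displayed non-divisibility condition for $\mathcal{A}_{s-1}$ (no condition if $s=1$), they are kept fixed and there exists $z_s\in\mathbb{Z}_n^*$ such that $(z_1,\ldots,z_s)$ satisfies the condition for $\mathcal{A}_s$. *)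

theory Defs
  imports Complex_Main "HOL-Number_Theory.Cong" "Jordan_Normal_Form.Matrix"
begin

text \<open>The lattice of integer vectors of dimension \<open>d\<close> is the carrier \<open>carrier_vec d :: int vec set\<close>.
  Vectors are indexed from \<open>0\<close>, so the component written \<open>h\<^sub>j\<close> for \<open>1 \<le> j \<le> d\<close> is \<open>h $ (j - 1)\<close>.\<close>

definition Zstar :: "nat \<Rightarrow> int set" where
  "Zstar n = {1..int n - 1}"

definition Zstar_vec :: "nat \<Rightarrow> nat \<Rightarrow> int vec set" where
  "Zstar_vec n s = {z \<in> carrier_vec s. \<forall>i<s. z $ i \<in> Zstar n}"

text \<open>The \<open>0\<close> inserted below only serves to make the maximum of the empty index set \<open>0\<close>;
  it has no effect when \<open>A\<close> is nonempty and \<open>d \<ge> 1\<close>.\<close>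

definition max_entry :: "nat \<Rightarrow> int vec set \<Rightarrow> int" where
  "max_entry d A = Max (insert 0 {\<bar>h $ j\<bar> | h j. h \<in> A \<and> j < d})"

definition centrally_symmetric :: "int vec set \<Rightarrow> bool" where
  "centrally_symmetric A \<longleftrightarrow> (\<forall>h\<in>A. - h \<in> A)"

definition kappa :: "int vec set \<Rightarrow> nat" where
  "kappa A = (if centrally_symmetric A then 2 else 1)"

definition zero_projection :: "nat \<Rightarrow> int vec set \<Rightarrow> nat \<Rightarrow> int vec set" where
  "zero_projection d A s = {h \<in> carrier_vec s. h @\<^sub>v 0\<^sub>v (d - s) \<in> A}"

definition full_projection :: "nat \<Rightarrow> int vec set \<Rightarrow> nat \<Rightarrow> int vec set" where
  "full_projection d A s = {h \<in> carrier_vec s. \<exists>h'\<in>carrier_vec (d - s). h @\<^sub>v h' \<in> A}"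

definition nondivisibility :: "nat \<Rightarrow> nat \<Rightarrow> int vec set \<Rightarrow> int vec \<Rightarrow> bool" where
  "nondivisibility n s B z \<longleftrightarrow> (\<forall>h \<in> B - {0\<^sub>v s}. \<not> [h \<bullet> z = 0] (mod int n))"

end

theory Submission
  imports Defs
begin

text \<open>
  The idea is to count, at step \<open>s\<close>, the values of the new component \<open>a\<close> that are forbidden when
  the earlier components \<open>z\<close> are fixed.  For \<open>h = (h', c)\<close> in the projected index set the condition
  reads \<open>h' \<bullet> z + c * a \<noteq> 0\<close> modulo \<open>n\<close>.

  If \<open>c = 0\<close>, the new component has no influence.  Both kinds of projection are closed under
  deleting a final zero (\<open>truncate_final_zero_in_projection\<close>), so \<open>h'\<close> is a nonzero member of the
  preceding projection and the condition is inherited.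

  If \<open>c \<noteq> 0\<close>, then \<open>\<bar>c\<bar> < n\<close> makes \<open>c\<close> invertible modulo the prime \<open>n\<close>, and \<open>h\<close> forbids at most
  one value in \<open>{1..n - 1}\<close> (\<open>linear_cong_unique_Zstar\<close>).  The vectors \<open>h\<close> and \<open>- h\<close> forbid the same
  value; hence under central symmetry it suffices to let one vector of each such pair vote
  (\<open>kappa_representatives\<close>), which is where \<open>\<kappa>\<close> comes from.

  Passing to a projection creates no new nonzero vectors and preserves central symmetry, so the
  number of forbidden values is at most \<open>#(A - {0}) / \<kappa>\<close>.  The bound on \<open>n\<close> makes this smaller
  than \<open>n - 1\<close>, so a permitted value is left (\<open>exists_next_component\<close>).  Iterating gives the
  whole generating vector.
\<close>

section \<open>Vectors extended by one component\<close>

lemma scalar_prod_append_singleton: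
  fixes h z :: "int vec"
  assumes "z \<in> carrier_vec m"
  shows "h \<bullet> (z @\<^sub>v vec 1 (\<lambda>_. a)) = vec_first h m \<bullet> z + h $ m * a"
  using assms by (simp add: scalar_prod_def vec_first_def)

lemma Zstar_vec_append_singleton:
  assumes "z \<in> Zstar_vec n m" "a \<in> Zstar n"
  shows "z @\<^sub>v vec 1 (\<lambda>_. a) \<in> Zstar_vec n (Suc m)"
  using assms by (auto simp: Zstar_vec_def less_Suc_eq intro!: carrier_vecI)

lemma vec_first_append_singleton:
  assumes "z \<in> carrier_vec m"
  shows "t \<le> m \<Longrightarrow> vec_first (z @\<^sub>v vec 1 (\<lambda>_. a)) t = vec_first z t"
    and "vec_first (z @\<^sub>v vec 1 (\<lambda>_. a)) (Suc m) = z @\<^sub>v vec 1 (\<lambda>_. a)"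
  using assms by (auto simp: vec_first_def)

section \<open>Projections of the index set\<close>

text \<open>Because of this inclusion, upper bounds on the size and on the entries of a projection need
  only be derived for the full projection, which is the image of \<open>A\<close> under truncation.\<close>

lemma zero_projection_subset_full_projection:
  "zero_projection d A s \<subseteq> full_projection d A s"
  unfolding zero_projection_def full_projection_def by fastforce

lemma full_projection_eq_vec_first_image:
  assumes "A \<subseteq> carrier_vec d" "s \<le> d"
  shows "full_projection d A s = (\<lambda>h. vec_first h s) ` A"
proof
  show "full_projection d A s \<subseteq> (\<lambda>h. vec_first h s) ` A"
  proof
    fix h assume "h \<in> full_projection d A s"
    then obtain h' where h: "h \<in> carrier_vec s" "h @\<^sub>v h' \<in> A"
      by (auto simp: full_projection_def)
    have "h = vec_first (h @\<^sub>v h') s"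
      using h(1) by (auto simp: vec_first_def)
    then show "h \<in> (\<lambda>h. vec_first h s) ` A"
      using h(2) by blast
  qed
next
  show "(\<lambda>h. vec_first h s) ` A \<subseteq> full_projection d A s"
  proof
    fix h assume "h \<in> (\<lambda>h. vec_first h s) ` A"
    then obtain v where v: "v \<in> A" "h = vec_first v s" by blast
    have "v \<in> carrier_vec (s + (d - s))" using assms v(1) by auto
    then have "vec_first v s @\<^sub>v vec_last v (d - s) = v"
      by (rule vec_first_last_append)
    then show "h \<in> full_projection d A s"
      using v unfolding full_projection_def
      by (auto intro!: bexI[of _ "vec_last v (d - s)"])
  qed
qed

text \<open>This is the compatibility between consecutive projections that carries the conditions
  already achieved over to the next step.  For the zero projection the deleted zero becomes part
  of the padding; for the full projection two truncations compose to one.\<close>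

lemma truncate_final_zero_in_projection:
  assumes "P = zero_projection d A \<or> P = full_projection d A" "Suc m \<le> d"
    and "h \<in> P (Suc m)" "h $ m = 0" "A \<subseteq> carrier_vec d"
  shows "vec_first h m \<in> P m"
  using assms(1)
proof
  assume P: "P = zero_projection d A"
  then have h: "h \<in> carrier_vec (Suc m)" "h @\<^sub>v 0\<^sub>v (d - Suc m) \<in> A"
    using assms(3) by (auto simp: zero_projection_def)
  have "vec_first h m @\<^sub>v 0\<^sub>v (d - m) = h @\<^sub>v 0\<^sub>v (d - Suc m)"
    using h(1) assms(2,4) by (intro eq_vecI) (auto simp: vec_first_def less_Suc_eq)
  then show ?thesis
    using h P by (simp add: zero_projection_def)
next
  assume P: "P = full_projection d A"
  then obtain v where "v \<in> A" "h = vec_first v (Suc m)"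
    using assms(2,3,5) by (auto simp: full_projection_eq_vec_first_image)
  moreover from this have "vec_first h m = vec_first v m"
    by (auto simp: vec_first_def)
  ultimately show ?thesis
    using P assms(2,5) by (auto simp: full_projection_eq_vec_first_image)
qed

text \<open>Padding by zeros and truncation both commute with negation.\<close>

lemma centrally_symmetric_projection:
  assumes "P = zero_projection d A \<or> P = full_projection d A" "s \<le> d"
    and "A \<subseteq> carrier_vec d" "centrally_symmetric A"
  shows "centrally_symmetric (P s)"
  using assms(1)
proof
  assume P: "P = zero_projection d A"
  have "- h @\<^sub>v 0\<^sub>v (d - s) = - (h @\<^sub>v 0\<^sub>v (d - s))" if "h \<in> carrier_vec s" for h :: "int vec"
    using that by auto
  then show ?thesis
    using P assms(4) by (auto simp: zero_projection_def centrally_symmetric_def)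
next
  assume P: "P = full_projection d A"
  have "- vec_first v s = vec_first (- v) s" if "v \<in> A" for v
    using that assms(2,3) by (intro eq_vecI) (auto simp: vec_first_def)
  then show ?thesis
    using P assms(2-4) by (auto simp: full_projection_eq_vec_first_image centrally_symmetric_def)
qed

text \<open>Since truncation sends \<open>0\<close> to \<open>0\<close>, every nonzero projected vector comes from a nonzero
  vector of \<open>A\<close>.\<close>

lemma card_projection_le:
  assumes "P = zero_projection d A \<or> P = full_projection d A" "s \<le> d"
    and "A \<subseteq> carrier_vec d" "finite A"
  shows "finite (P s)" and "card (P s - {0\<^sub>v s}) \<le> card (A - {0\<^sub>v d})"
proof -
  have sub: "P s \<subseteq> (\<lambda>h. vec_first h s) ` A"
    using assms(1-3) zero_projection_subset_full_projection[of d A s]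
    by (auto simp: full_projection_eq_vec_first_image)
  then show "finite (P s)"
    using assms(4) finite_subset by blast
  have "vec_first (0\<^sub>v d :: int vec) s = 0\<^sub>v s"
    using assms(2) by (auto simp: vec_first_def)
  then have "P s - {0\<^sub>v s} \<subseteq> (\<lambda>h. vec_first h s) ` (A - {0\<^sub>v d})"
    using sub by auto
  then show "card (P s - {0\<^sub>v s}) \<le> card (A - {0\<^sub>v d})"
    using assms(4) by (meson card_image_le card_mono finite_Diff finite_imageI le_trans)
qed

lemma abs_entry_projection_le:
  assumes "P = zero_projection d A \<or> P = full_projection d A" "s \<le> d"
    and "A \<subseteq> carrier_vec d" "finite A" "h \<in> P s" "i < s"
  shows "\<bar>h $ i\<bar> \<le> max_entry d A"
proof -
  have "h \<in> (\<lambda>h. vec_first h s) ` A"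
    using assms(1-3,5) zero_projection_subset_full_projection[of d A s]
    by (auto simp: full_projection_eq_vec_first_image)
  then obtain v where v: "v \<in> A" "h $ i = v $ i"
    using assms(6) by (auto simp: vec_first_def)
  have "{\<bar>h $ j\<bar> | h j. h \<in> A \<and> j < d} = (\<lambda>(h, j). \<bar>h $ j\<bar>) ` (A \<times> {..<d})"
    by auto
  then have "finite {\<bar>h $ j\<bar> | h j. h \<in> A \<and> j < d}"
    using assms(4) by simp
  then show ?thesis
    unfolding max_entry_def using v assms(2,6) by (intro Max_ge insertI2) force+
qed

section \<open>Counting forbidden values\<close>

text \<open>In the centrally symmetric case the representatives are the vectors whose \<open>i\<close>-th component
  is positive: negation carries them injectively to vectors with negative \<open>i\<close>-th component, so
  \<open>B - {0}\<close> contains two disjoint copies of the set of representatives.\<close>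

lemma kappa_representatives:
  assumes "finite B" "B \<subseteq> carrier_vec s" "i < s"
  obtains C where "C \<subseteq> B" "\<forall>h\<in>C. h $ i \<noteq> 0"
    "\<forall>h\<in>B. h $ i \<noteq> 0 \<longrightarrow> h \<in> C \<or> - h \<in> C" "kappa B * card C \<le> card (B - {0\<^sub>v s})"
proof (cases "centrally_symmetric B")
  case True
  define C where "C = {h \<in> B. h $ i > 0}"
  have neg: "(- h) $ i = - (h $ i)" if "h \<in> B" for h
    using that assms(2,3) by auto
  have fin: "finite C"
    using assms(1) by (simp add: C_def)
  have inj: "inj_on uminus C"
    by (rule inj_onI) (metis uminus_uminus_vec)
  have disj: "C \<inter> uminus ` C = {}"
    using neg by (auto simp: C_def)
  have "h $ i \<noteq> 0" if "h \<in> C \<union> uminus ` C" for h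
    using that neg by (auto simp: C_def)
  then have "0\<^sub>v s \<notin> C \<union> uminus ` C"
    using assms(3) by (metis index_zero_vec(1))
  moreover have "C \<union> uminus ` C \<subseteq> B"
    using True by (auto simp: C_def centrally_symmetric_def)
  ultimately have "C \<union> uminus ` C \<subseteq> B - {0\<^sub>v s}"
    by blast
  then have "card (C \<union> uminus ` C) \<le> card (B - {0\<^sub>v s})"
    using assms(1) by (simp add: card_mono)
  moreover have "card (C \<union> uminus ` C) = 2 * card C"
    using fin disj inj by (simp add: card_Un_disjoint card_image)
  ultimately have "kappa B * card C \<le> card (B - {0\<^sub>v s})"
    using True by (simp add: kappa_def)
  moreover have "h \<in> C \<or> - h \<in> C" if "h \<in> B" "h $ i \<noteq> 0" for h
    using that True neg[of h] by (auto simp: C_def centrally_symmetric_def)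
  ultimately show ?thesis
    by (intro that[of C]) (auto simp: C_def)
next
  case False
  define C where "C = {h \<in> B. h $ i \<noteq> 0}"
  have "C \<subseteq> B - {0\<^sub>v s}"
    using assms(3) by (auto simp: C_def)
  then have "kappa B * card C \<le> card (B - {0\<^sub>v s})"
    using False assms(1) by (simp add: kappa_def card_mono)
  then show ?thesis
    by (intro that[of C]) (auto simp: C_def)
qed

text \<open>Two solutions would make the prime \<open>n\<close> divide \<open>c * (x - y)\<close>, although both factors are
  smaller than \<open>n\<close> in absolute value and \<open>c\<close> is nonzero.\<close>

lemma linear_cong_unique_Zstar:
  fixes b c x y :: int
  assumes "prime n" "c \<noteq> 0" "\<bar>c\<bar> < int n" "x \<in> Zstar n" "y \<in> Zstar n"
    and "[b + c * x = 0] (mod int n)" "[b + c * y = 0] (mod int n)"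
  shows "x = y"
proof -
  have "int n dvd (b + c * x) - (b + c * y)"
    using assms(6,7) by (intro dvd_diff) (simp_all add: cong_0_iff)
  then have "int n dvd c * (x - y)"
    by (simp add: algebra_simps)
  moreover have "\<not> int n dvd c"
    using assms(2,3) dvd_imp_le_int[of c "int n"] by auto
  ultimately have "int n dvd x - y"
    using assms(1) by (simp add: prime_dvd_mult_iff)
  moreover have "\<bar>x - y\<bar> < int n"
    using assms(4,5) by (auto simp: Zstar_def)
  ultimately show ?thesis
    using dvd_imp_le_int[of "x - y" "int n"] by auto
qed

section \<open>Choosing the components\<close>

text \<open>The hypothesis \<open>count\<close> is the bound on \<open>n\<close> cleared of denominators.  Every forbidden value is
  charged to a representative that forbids it; no representative is charged twice, so there are
  fewer forbidden values than elements of \<open>Zstar n\<close>.\<close>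

lemma exists_next_component:
  assumes "prime n" "finite B" "B \<subseteq> carrier_vec (Suc m)" "z \<in> carrier_vec m"
    and old: "\<And>h. h \<in> B \<Longrightarrow> h \<noteq> 0\<^sub>v (Suc m) \<Longrightarrow> h $ m = 0 \<Longrightarrow>
                 \<not> [vec_first h m \<bullet> z = 0] (mod int n)"
    and small: "\<And>h. h \<in> B \<Longrightarrow> \<bar>h $ m\<bar> < int n"
    and count: "card (B - {0\<^sub>v (Suc m)}) < kappa B * (n - 1)"
  shows "\<exists>a \<in> Zstar n. nondivisibility n (Suc m) B (z @\<^sub>v vec 1 (\<lambda>_. a))"
proof -
  obtain C where C: "C \<subseteq> B" "\<forall>h\<in>C. h $ m \<noteq> 0"
      "\<forall>h\<in>B. h $ m \<noteq> 0 \<longrightarrow> h \<in> C \<or> - h \<in> C"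
      "kappa B * card C \<le> card (B - {0\<^sub>v (Suc m)})"
    using kappa_representatives[OF assms(2,3), of m] by auto
  let ?bad = "\<lambda>a h. [h \<bullet> (z @\<^sub>v vec 1 (\<lambda>_. a)) = 0] (mod int n)"
  let ?X = "{a \<in> Zstar n. \<exists>h\<in>C. ?bad a h}"
  have "card ?X \<le> card C"
  proof (rule card_le_if_inj_on_rel[where r = ?bad])
    show "finite C"
      using C(1) assms(2) finite_subset by blast
    show "x = y" if "x \<in> ?X" "y \<in> ?X" "h \<in> C" "?bad x h" "?bad y h" for x y h
    proof (rule linear_cong_unique_Zstar[OF assms(1)])
      show "h $ m \<noteq> 0" "\<bar>h $ m\<bar> < int n"
        using that(3) C(1,2) small by auto
      show "[vec_first h m \<bullet> z + h $ m * x = 0] (mod int n)"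
        "[vec_first h m \<bullet> z + h $ m * y = 0] (mod int n)"
        using that(4,5) by (simp_all only: scalar_prod_append_singleton[OF assms(4)])
    qed (use that in auto)
  qed auto
  also have "card C < n - 1"
    using C(4) count by (metis le_less_trans nat_mult_less_cancel_disj)
  also have "n - 1 = card (Zstar n)"
    by (simp add: Zstar_def)
  finally have "?X \<noteq> Zstar n"
    by (metis less_irrefl)
  then obtain a where a: "a \<in> Zstar n" "\<forall>h\<in>C. \<not> ?bad a h"
    by blast
  have "\<not> ?bad a h" if h: "h \<in> B" "h \<noteq> 0\<^sub>v (Suc m)" for h
  proof (cases "h $ m = 0")
    case True
    then show ?thesis
      using old[OF h True] by (simp only: scalar_prod_append_singleton[OF assms(4)]) simp
  next
    case False
    have "(- h) \<bullet> (z @\<^sub>v vec 1 (\<lambda>_. a)) = - (h \<bullet> (z @\<^sub>v vec 1 (\<lambda>_. a)))"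
      using assms(3,4) h(1) by (intro scalar_prod_uminus_left) auto
    then have "?bad a (- h) \<longleftrightarrow> ?bad a h"
      by (simp add: cong_0_iff)
    then show ?thesis
      using False C(3) h(1) a(2) by blast
  qed
  then show ?thesis
    using a(1) by (auto simp: nondivisibility_def)
qed

text \<open>The exception \<open>m = 0\<close> in the premise of the step lets the construction start from the empty
  vector.  Appending a component does not change shorter initial segments, so the conditions
  already achieved persist.\<close>

lemma component_by_component:
  assumes step: "\<And>m z. \<lbrakk>Suc m \<le> d; z \<in> Zstar_vec n m; m = 0 \<or> nondivisibility n m (P m) z\<rbrakk>
      \<Longrightarrow> \<exists>a \<in> Zstar n. nondivisibility n (Suc m) (P (Suc m)) (z @\<^sub>v vec 1 (\<lambda>_. a))"
    and "m \<le> d"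
  shows "\<exists>z \<in> Zstar_vec n m. \<forall>s\<in>{1..m}. nondivisibility n s (P s) (vec_first z s)"
  using \<open>m \<le> d\<close>
proof (induction m)
  case 0
  have "0\<^sub>v 0 \<in> Zstar_vec n 0"
    by (simp add: Zstar_vec_def)
  then show ?case
    by auto
next
  case (Suc m)
  then obtain z where z: "z \<in> Zstar_vec n m"
      "\<forall>s\<in>{1..m}. nondivisibility n s (P s) (vec_first z s)"
    by auto
  have dim: "z \<in> carrier_vec m"
    using z(1) by (simp add: Zstar_vec_def)
  have "vec_first z m = z"
    using dim by (auto simp: vec_first_def)
  then have "m = 0 \<or> nondivisibility n m (P m) z"
    using z(2)[rule_format, of m] by (cases m) auto
  then obtain a where a: "a \<in> Zstar n"
      "nondivisibility n (Suc m) (P (Suc m)) (z @\<^sub>v vec 1 (\<lambda>_. a))"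
    using step[OF Suc.prems z(1)] by blast
  show ?case
  proof (rule bexI[OF _ Zstar_vec_append_singleton[OF z(1) a(1)]], rule ballI)
    fix s assume "s \<in> {1..Suc m}"
    then show "nondivisibility n s (P s) (vec_first (z @\<^sub>v vec 1 (\<lambda>_. a)) s)"
      using z(2) a(2) by (cases "s = Suc m") (auto simp: vec_first_append_singleton[OF dim] simp del: One_nat_def)
  qed
qed

theorem theorem23:
  fixes d n :: nat and A :: "int vec set" and P :: "nat \<Rightarrow> int vec set"
  assumes "d \<ge> 1"
    and "A \<subseteq> carrier_vec d" and "finite A"
    and "prime n"
    and "real n > max (real (card (A - {0\<^sub>v d})) / real (kappa A) + 1) (real_of_int (max_entry d A))"
    and "P = zero_projection d A \<or> P = full_projection d A"
  shows "(\<forall>s\<in>{1..d}. \<forall>z \<in> Zstar_vec n (s - 1).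
            (s = 1 \<or> nondivisibility n (s - 1) (P (s - 1)) z) \<longrightarrow>
            (\<exists>a \<in> Zstar n. nondivisibility n s (P s) (z @\<^sub>v vec 1 (\<lambda>_. a))))
       \<and> (\<exists>z \<in> Zstar_vec n d. \<forall>s\<in>{1..d}. nondivisibility n s (P s) (vec_first z s))"
proof -
  have n1: "n \<ge> 1"
    using \<open>prime n\<close> prime_ge_1_nat by blast
  have kappa_pos: "kappa A > 0"
    by (simp add: kappa_def)
  have "real (card (A - {0\<^sub>v d})) / real (kappa A) < real (n - 1)"
    using assms(5) n1 by (simp add: of_nat_diff)
  then have "real (card (A - {0\<^sub>v d})) < real (kappa A * (n - 1))"
    using kappa_pos by (simp add: pos_divide_less_eq mult.commute del: of_nat_diff)
  then have count: "card (A - {0\<^sub>v d}) < kappa A * (n - 1)"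
    by (simp only: of_nat_less_iff)
  have entry: "max_entry d A < int n"
    using assms(5) by linarith
  have step: "\<exists>a \<in> Zstar n. nondivisibility n (Suc m) (P (Suc m)) (z @\<^sub>v vec 1 (\<lambda>_. a))"
    if m: "Suc m \<le> d" and z: "z \<in> Zstar_vec n m"
      and old: "m = 0 \<or> nondivisibility n m (P m) z" for m z
  proof (rule exists_next_component[OF \<open>prime n\<close>])
    note proj = assms(6) m assms(2)
    show "finite (P (Suc m))"
      using card_projection_le(1)[OF proj assms(3)] .
    show dim: "P (Suc m) \<subseteq> carrier_vec (Suc m)"
      using assms(6) by (auto simp: zero_projection_def full_projection_def)
    show "z \<in> carrier_vec m"
      using z by (simp add: Zstar_vec_def)
    show "\<bar>h $ m\<bar> < int n" if "h \<in> P (Suc m)" for h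
      using abs_entry_projection_le[OF proj assms(3) that, of m] entry by simp
    show "\<not> [vec_first h m \<bullet> z = 0] (mod int n)"
      if h: "h \<in> P (Suc m)" "h \<noteq> 0\<^sub>v (Suc m)" "h $ m = 0" for h
    proof -
      have ne: "vec_first h m \<noteq> 0\<^sub>v m"
      proof
        assume eq: "vec_first h m = 0\<^sub>v m"
        have "h $ i = 0" if "i < m" for i
          using arg_cong[OF eq, of "\<lambda>v. v $ i"] that by (simp add: vec_first_def)
        then have "h = 0\<^sub>v (Suc m)"
          using h(1,3) dim by (auto simp: less_Suc_eq intro!: eq_vecI)
        then show False
          using h(2) by simp
      qed
      (* A vector of dimension one ending in 0 vanishes, so this case arises only for m > 0. *)
      then have "m \<noteq> 0"
        by (auto simp: vec_first_def)
      then show ?thesis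
        using old ne truncate_final_zero_in_projection[OF assms(6) m h(1,3) assms(2)]
        by (auto simp: nondivisibility_def)
    qed
    (* Strict inequality can occur: truncation may symmetrize a set that is not symmetric. *)
    have "kappa A \<le> kappa (P (Suc m))"
      using centrally_symmetric_projection[OF proj] by (auto simp: kappa_def)
    then show "card (P (Suc m) - {0\<^sub>v (Suc m)}) < kappa (P (Suc m)) * (n - 1)"
      using card_projection_le(2)[OF proj assms(3)] count
      by (meson le_less_trans less_le_trans mult_le_mono1)
  qed
  have "\<exists>a \<in> Zstar n. nondivisibility n s (P s) (z @\<^sub>v vec 1 (\<lambda>_. a))"
    if "s \<in> {1..d}" "z \<in> Zstar_vec n (s - 1)"
      "s = 1 \<or> nondivisibility n (s - 1) (P (s - 1)) z" for s z
    using that step[of "s - 1" z] by (cases s) auto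
  moreover have "\<exists>z \<in> Zstar_vec n d. \<forall>s\<in>{1..d}. nondivisibility n s (P s) (vec_first z s)"
    using component_by_component[OF step, of d] by blast
  ultimately show ?thesis
    by blast
qed

end
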